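(* Let $M:\Psi=\Psi(s,t)$ be a solution of the Betchov-Da Rios equation $\Psi_t=\Psi_s\times\Psi_{ss}\times\Psi_{sss}$ in $E^4$ (with unit speed $s$-parameter curves), with its parallel transport frame field. Then the origin $p$ of the normal space $T_p^{\bot}M$ can be classified by the following cases (all functions evaluated at $p$): (a) If $\mathcal{B}^2+4Q^2\mathcal{A}\mathcal{C}^2>0$, then $p$ lies outside the curvature ellipse and so it is a hyperbolic point of $M$. (b) If $\mathcal{B}^2+4Q^2\mathcal{A}\mathcal{C}^2<0$, then $p$ lies inside the curvature ellipse and so it is an elliptic point of $M$. (c) If $\mathcal{B}^2+4Q^2\mathcal{A}\mathcal{C}^2=0$, then $p$ lies on the curvature ellipse and so it is a parabolic point of $M$. Moreover, in this case: (i) if $\mathcal{A}>0$ and $\mathcal{B}=\mathcal{C}=0$, then $p$ is an inflection point of imaginary type; (ii) if "$\mathcal{A}<0$ and $\mathcal{B}^2+4Q^2\mathcal{A}\mathcal{C}^2=0$" or "$\mathcal{A}=\mathcal{B}=0\neq\mathcal{C}$", then the curvature ellipse at $p$ is non-degenerate; (iii) if $\mathcal{A}=\mathcal{B}=\mathcal{C}=0$, then $p$ is an inflection point of flat type.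
   Context: Setting. $E^4$ is $\mathbb{R}^4$ with its standard inner product $\langle\cdot,\cdot\rangle$ and orientation; the ternary vector product $x\times y\times z$ is the formal determinant of the $4\times4$ matrix whose first row is the standard basis $(e_1,e_2,e_3,e_4)$ and whose remaining rows are $x,y,z$. Subscripts $s,t$ denote partial derivatives. $\Psi=\Psi(s,t)$ is a smooth map from a product of two open intervals to $E^4$ whose $s$-parameter curves $s\mapsto\Psi(s,t)$ are unit speed for all $t$. A parallel transport frame field is a smooth positively oriented orthonormal frame $\{\mathcal{T},\mathcal{P}_1,\mathcal{P}_2,\mathcal{P}_3\}$ along $\Psi$ with $\mathcal{T}=\Psi_s$, $\mathcal{T}_s=k_1\mathcal{P}_1+k_2\mathcal{P}_2+k_3\mathcal{P}_3$ and $(\mathcal{P}_i)_s=-k_i\mathcal{T}$; $k_1,k_2,k_3$ are its curvature functions. Put $\mathfrak{a}_{23}=\langle(\mathcal{P}_1)_t,\mathcal{P}_2\rangle$, $\mathfrak{a}_{24}=\langle(\mathcal{P}_1)_t,\mathcal{P}_3\rangle$, $\mathfrak{a}_{34}=\langle(\mathcal{P}_2)_t,\mathcal{P}_3\rangle$, $P=k_3(k_2)_s-k_2(k_3)_s$, $R=k_1(k_3)_s-k_3(k_1)_s$, $S=k_2(k_1)_s-k_1(k_2)_s$, $Q=\sqrt{k_1^2+k_2^2+k_3^2}$, $\mathcal{W}=\sqrt{P^2+R^2+S^2}$, and $\mathcal{A}=(Pk_3-Sk_1)\mathfrak{a}_{24}+(Pk_2-Rk_1)\mathfrak{a}_{23}+(Rk_3-Sk_2)\mathfrak{a}_{34}-R(k_2)_t-S(k_3)_t-P(k_1)_t$,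 $\mathcal{B}=\mathcal{W}^2(k_1\mathfrak{a}_{34}-k_2\mathfrak{a}_{24}+k_3\mathfrak{a}_{23})+S(k_2P_t-k_1R_t)+R(k_1S_t-k_3P_t)+P(k_3R_t-k_2S_t)$, $\mathcal{C}=(k_1)_sP_s+(k_2)_sR_s+(k_3)_sS_s$. Standing assumptions: at least two of $k_1,k_2,k_3$ are non-zero, and $P,R,S$ are not all zero at any point. Curvature ellipse and types of points. Use the orthonormal normal frame $N_1=\frac{1}{Q}(k_1\mathcal{P}_1+k_2\mathcal{P}_2+k_3\mathcal{P}_3)$, $N_2=\frac{1}{Q\mathcal{W}}\big((k_2S-k_3R)\mathcal{P}_1+(k_3P-k_1S)\mathcal{P}_2+(k_1R-k_2P)\mathcal{P}_3\big)$ and the orthonormal tangent frame $\Psi_s,\ \Psi_t/\mathcal{W}$. Let $h^i_{11}=\langle\Psi_{ss},N_i\rangle$, $h^i_{12}=\frac{1}{\mathcal{W}}\langle\Psi_{st},N_i\rangle$, $h^i_{22}=\frac{1}{\mathcal{W}^2}\langle\Psi_{tt},N_i\rangle$ be the coefficients of the second fundamental forms $h_{N_i}$, $i=1,2$. The curvature ellipse at $p$ is $\{(h_{N_1}(X,X),h_{N_2}(X,X)):X\in T_pM,\ \|X\|=1\}$. Put $K=\sum_{i=1}^2\big(h^i_{11}h^i_{22}-(h^i_{12})^2\big)$ (Gaussian curvature), $$\Delta(p)=\frac14\det\begin{bmatrix} h_{11}^1 & 2h_{12}^1 & h_{22}^1 & 0 \\ h_{11}^2 & 2h_{12}^2 &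 h_{22}^2 & 0 \\ 0 & h_{11}^1 & 2h_{12}^1 & h_{22}^1 \\ 0 & h_{11}^2 & 2h_{12}^2 & h_{22}^2 \end{bmatrix}(p),\qquad A(p)=\begin{bmatrix} h_{11}^1 & h_{12}^1 & h_{22}^1 \\ h_{11}^2 & h_{12}^2 & h_{22}^2 \end{bmatrix}(p).$$ The paper uses the following terminology for the origin $p$ of the normal space: if $\Delta(p)<0$, $p$ is said to lie outside the curvature ellipse and is called hyperbolic; if $\Delta(p)>0$, $p$ is said to lie inside the curvature ellipse and is called elliptic; if $\Delta(p)=0$, $p$ is said to lie on the curvature ellipse and is called parabolic. When $\Delta(p)=0$: if $K(p)>0$, $p$ is an inflection point of imaginary type; if $K(p)<0$ and $\operatorname{rank}A(p)=2$, the ellipse is non-degenerate; if $K(p)<0$ and $\operatorname{rank}A(p)=1$, $p$ is an inflection point of real type; if $K(p)=0$, $p$ is an inflection point of flat type.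
   Formalization: In (c)(ii), first alternative, the condition that B and C are not both zero is added: if A<0 and B=C=0 then rank A(p)=1, so p is an inflection point of real type and the ellipse is degenerate; such points do occur on solutions. *)

theory Defs
  imports "HOL-Analysis.Analysis"
begin

fun C_k_on :: "nat \<Rightarrow> ('a::euclidean_space) set \<Rightarrow> ('a \<Rightarrow> 'b::real_normed_vector) \<Rightarrow> bool" where
  "C_k_on 0 U f \<longleftrightarrow> continuous_on U f"
| "C_k_on (Suc n) U f \<longleftrightarrow>
     (\<forall>x\<in>U. f differentiable (at x)) \<and>
     (\<forall>v. C_k_on n U (\<lambda>x. frechet_derivative f (at x) v))"

definition smooth_on :: "('a::euclidean_space) set \<Rightarrow> ('a \<Rightarrow> 'b::real_normed_vector) \<Rightarrow> bool" where
  "smooth_on U f \<longleftrightarrow> (\<forall>n. C_k_on n U f)"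

definition D_s :: "(real \<Rightarrow> real \<Rightarrow> 'a::real_normed_vector) \<Rightarrow> real \<Rightarrow> real \<Rightarrow> 'a" where
  "D_s F s t = vector_derivative (\<lambda>u. F u t) (at s)"

definition D_t :: "(real \<Rightarrow> real \<Rightarrow> 'a::real_normed_vector) \<Rightarrow> real \<Rightarrow> real \<Rightarrow> 'a" where
  "D_t F s t = vector_derivative (\<lambda>u. F s u) (at t)"

(* The formal determinant with first row (e_1, ..., e_4): its e_i-coefficient is the determinant
   whose first row is e_i. *)
definition cross4 :: "real^4 \<Rightarrow> real^4 \<Rightarrow> real^4 \<Rightarrow> real^4" where
  "cross4 x y z = (\<chi> i. det (vector [axis i 1, x, y, z] :: real^4^4))"

definition unit_speed_map :: "real set \<Rightarrow> real set \<Rightarrow> (real \<Rightarrow> real \<Rightarrow> real^4) \<Rightarrow> bool" where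
  "unit_speed_map I J \<Psi> \<longleftrightarrow>
     open I \<and> is_interval I \<and> open J \<and> is_interval J \<and>
     smooth_on (I \<times> J) (\<lambda>(s, t). \<Psi> s t) \<and>
     (\<forall>s\<in>I. \<forall>t\<in>J. norm (D_s \<Psi> s t) = 1)"

definition Betchov_Da_Rios :: "real set \<Rightarrow> real set \<Rightarrow> (real \<Rightarrow> real \<Rightarrow> real^4) \<Rightarrow> bool" where
  "Betchov_Da_Rios I J \<Psi> \<longleftrightarrow>
     (\<forall>s\<in>I. \<forall>t\<in>J.
        D_t \<Psi> s t = cross4 (D_s \<Psi> s t) (D_s (D_s \<Psi>) s t) (D_s (D_s (D_s \<Psi>)) s t))"

(* Families indexed by nat (the frame vectors p, the curvatures k and the normals) are only
   used at the indices 1, 2, 3; their other values are irrelevant. *)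
definition parallel_transport_frame ::
  "real set \<Rightarrow> real set \<Rightarrow> (real \<Rightarrow> real \<Rightarrow> real^4) \<Rightarrow> (real \<Rightarrow> real \<Rightarrow> real^4) \<Rightarrow>
   (nat \<Rightarrow> real \<Rightarrow> real \<Rightarrow> real^4) \<Rightarrow> (nat \<Rightarrow> real \<Rightarrow> real \<Rightarrow> real) \<Rightarrow> bool" where
  "parallel_transport_frame I J \<Psi> T p k \<longleftrightarrow>
     smooth_on (I \<times> J) (\<lambda>(s, t). T s t) \<and>
     (\<forall>i\<in>{1..3}. smooth_on (I \<times> J) (\<lambda>(s, t). p i s t)) \<and>
     (\<forall>s\<in>I. \<forall>t\<in>J.
        norm (T s t) = 1 \<and>
        (\<forall>i\<in>{1..3}. T s t \<bullet> p i s t = 0) \<and>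
        (\<forall>i\<in>{1..3}. \<forall>j\<in>{1..3}. p i s t \<bullet> p j s t = (if i = j then 1 else 0)) \<and>
        det (vector [T s t, p 1 s t, p 2 s t, p 3 s t] :: real^4^4) > 0 \<and>
        T s t = D_s \<Psi> s t \<and>
        D_s T s t = k 1 s t *\<^sub>R p 1 s t + k 2 s t *\<^sub>R p 2 s t + k 3 s t *\<^sub>R p 3 s t \<and>
        (\<forall>i\<in>{1..3}. D_s (p i) s t = - (k i s t) *\<^sub>R T s t))"

definition fr_a23 :: "(nat \<Rightarrow> real \<Rightarrow> real \<Rightarrow> real^4) \<Rightarrow> real \<Rightarrow> real \<Rightarrow> real" where
  "fr_a23 p s t = D_t (p 1) s t \<bullet> p 2 s t"

definition fr_a24 :: "(nat \<Rightarrow> real \<Rightarrow> real \<Rightarrow> real^4) \<Rightarrow> real \<Rightarrow> real \<Rightarrow> real" where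
  "fr_a24 p s t = D_t (p 1) s t \<bullet> p 3 s t"

definition fr_a34 :: "(nat \<Rightarrow> real \<Rightarrow> real \<Rightarrow> real^4) \<Rightarrow> real \<Rightarrow> real \<Rightarrow> real" where
  "fr_a34 p s t = D_t (p 2) s t \<bullet> p 3 s t"

definition fun_P :: "(nat \<Rightarrow> real \<Rightarrow> real \<Rightarrow> real) \<Rightarrow> real \<Rightarrow> real \<Rightarrow> real" where
  "fun_P k s t = k 3 s t * D_s (k 2) s t - k 2 s t * D_s (k 3) s t"

definition fun_R :: "(nat \<Rightarrow> real \<Rightarrow> real \<Rightarrow> real) \<Rightarrow> real \<Rightarrow> real \<Rightarrow> real" where
  "fun_R k s t = k 1 s t * D_s (k 3) s t - k 3 s t * D_s (k 1) s t"

definition fun_S :: "(nat \<Rightarrow> real \<Rightarrow> real \<Rightarrow> real) \<Rightarrow> real \<Rightarrow> real \<Rightarrow> real" where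
  "fun_S k s t = k 2 s t * D_s (k 1) s t - k 1 s t * D_s (k 2) s t"

definition fun_Q :: "(nat \<Rightarrow> real \<Rightarrow> real \<Rightarrow> real) \<Rightarrow> real \<Rightarrow> real \<Rightarrow> real" where
  "fun_Q k s t = sqrt ((k 1 s t)\<^sup>2 + (k 2 s t)\<^sup>2 + (k 3 s t)\<^sup>2)"

definition fun_W :: "(nat \<Rightarrow> real \<Rightarrow> real \<Rightarrow> real) \<Rightarrow> real \<Rightarrow> real \<Rightarrow> real" where
  "fun_W k s t = sqrt ((fun_P k s t)\<^sup>2 + (fun_R k s t)\<^sup>2 + (fun_S k s t)\<^sup>2)"

definition fun_A ::
  "(nat \<Rightarrow> real \<Rightarrow> real \<Rightarrow> real^4) \<Rightarrow> (nat \<Rightarrow> real \<Rightarrow> real \<Rightarrow> real) \<Rightarrow> real \<Rightarrow> real \<Rightarrow> real" where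
  "fun_A p k s t =
     (fun_P k s t * k 3 s t - fun_S k s t * k 1 s t) * fr_a24 p s t
     + (fun_P k s t * k 2 s t - fun_R k s t * k 1 s t) * fr_a23 p s t
     + (fun_R k s t * k 3 s t - fun_S k s t * k 2 s t) * fr_a34 p s t
     - fun_R k s t * D_t (k 2) s t - fun_S k s t * D_t (k 3) s t - fun_P k s t * D_t (k 1) s t"

definition fun_B ::
  "(nat \<Rightarrow> real \<Rightarrow> real \<Rightarrow> real^4) \<Rightarrow> (nat \<Rightarrow> real \<Rightarrow> real \<Rightarrow> real) \<Rightarrow> real \<Rightarrow> real \<Rightarrow> real" where
  "fun_B p k s t =
     (fun_W k s t)\<^sup>2 * (k 1 s t * fr_a34 p s t - k 2 s t * fr_a24 p s t + k 3 s t * fr_a23 p s t)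
     + fun_S k s t * (k 2 s t * D_t (fun_P k) s t - k 1 s t * D_t (fun_R k) s t)
     + fun_R k s t * (k 1 s t * D_t (fun_S k) s t - k 3 s t * D_t (fun_P k) s t)
     + fun_P k s t * (k 3 s t * D_t (fun_R k) s t - k 2 s t * D_t (fun_S k) s t)"

definition fun_C :: "(nat \<Rightarrow> real \<Rightarrow> real \<Rightarrow> real) \<Rightarrow> real \<Rightarrow> real \<Rightarrow> real" where
  "fun_C k s t =
     D_s (k 1) s t * D_s (fun_P k) s t + D_s (k 2) s t * D_s (fun_R k) s t
     + D_s (k 3) s t * D_s (fun_S k) s t"

(* "At least two of the k_i are non-zero" is taken for the functions: at least two of them do
   not vanish identically. The pointwise reading implies this one. *)
definition standing_assumptions ::
  "real set \<Rightarrow> real set \<Rightarrow> (nat \<Rightarrow> real \<Rightarrow> real \<Rightarrow> real) \<Rightarrow> bool" where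
  "standing_assumptions I J k \<longleftrightarrow>
     card {i \<in> {1..3}. \<exists>s\<in>I. \<exists>t\<in>J. k i s t \<noteq> 0} \<ge> 2 \<and>
     (\<forall>s\<in>I. \<forall>t\<in>J. \<not> (fun_P k s t = 0 \<and> fun_R k s t = 0 \<and> fun_S k s t = 0))"

definition normal_N ::
  "(nat \<Rightarrow> real \<Rightarrow> real \<Rightarrow> real^4) \<Rightarrow> (nat \<Rightarrow> real \<Rightarrow> real \<Rightarrow> real) \<Rightarrow>
   nat \<Rightarrow> real \<Rightarrow> real \<Rightarrow> real^4" where
  "normal_N p k i s t =
     (if i = 1 then
        (1 / fun_Q k s t) *\<^sub>R
          (k 1 s t *\<^sub>R p 1 s t + k 2 s t *\<^sub>R p 2 s t + k 3 s t *\<^sub>R p 3 s t)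
      else
        (1 / (fun_Q k s t * fun_W k s t)) *\<^sub>R
          ((k 2 s t * fun_S k s t - k 3 s t * fun_R k s t) *\<^sub>R p 1 s t
           + (k 3 s t * fun_P k s t - k 1 s t * fun_S k s t) *\<^sub>R p 2 s t
           + (k 1 s t * fun_R k s t - k 2 s t * fun_P k s t) *\<^sub>R p 3 s t))"

(* Coefficients of the second fundamental form h_{N_i} in the orthonormal tangent frame
   Psi_s, Psi_t / W. *)
definition h11 ::
  "(real \<Rightarrow> real \<Rightarrow> real^4) \<Rightarrow> (nat \<Rightarrow> real \<Rightarrow> real \<Rightarrow> real^4) \<Rightarrow>
   (nat \<Rightarrow> real \<Rightarrow> real \<Rightarrow> real) \<Rightarrow> nat \<Rightarrow> real \<Rightarrow> real \<Rightarrow> real" where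
  "h11 \<Psi> p k i s t = D_s (D_s \<Psi>) s t \<bullet> normal_N p k i s t"

definition h12 ::
  "(real \<Rightarrow> real \<Rightarrow> real^4) \<Rightarrow> (nat \<Rightarrow> real \<Rightarrow> real \<Rightarrow> real^4) \<Rightarrow>
   (nat \<Rightarrow> real \<Rightarrow> real \<Rightarrow> real) \<Rightarrow> nat \<Rightarrow> real \<Rightarrow> real \<Rightarrow> real" where
  "h12 \<Psi> p k i s t = 1 / fun_W k s t * (D_t (D_s \<Psi>) s t \<bullet> normal_N p k i s t)"

definition h22 ::
  "(real \<Rightarrow> real \<Rightarrow> real^4) \<Rightarrow> (nat \<Rightarrow> real \<Rightarrow> real \<Rightarrow> real^4) \<Rightarrow>
   (nat \<Rightarrow> real \<Rightarrow> real \<Rightarrow> real) \<Rightarrow> nat \<Rightarrow> real \<Rightarrow> real \<Rightarrow> real" where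
  "h22 \<Psi> p k i s t = 1 / (fun_W k s t)\<^sup>2 * (D_t (D_t \<Psi>) s t \<bullet> normal_N p k i s t)"

definition Gaussian_K ::
  "(real \<Rightarrow> real \<Rightarrow> real^4) \<Rightarrow> (nat \<Rightarrow> real \<Rightarrow> real \<Rightarrow> real^4) \<Rightarrow>
   (nat \<Rightarrow> real \<Rightarrow> real \<Rightarrow> real) \<Rightarrow> real \<Rightarrow> real \<Rightarrow> real" where
  "Gaussian_K \<Psi> p k s t =
     (\<Sum>i=1..2. h11 \<Psi> p k i s t * h22 \<Psi> p k i s t - (h12 \<Psi> p k i s t)\<^sup>2)"

definition ellipse_Delta ::
  "(real \<Rightarrow> real \<Rightarrow> real^4) \<Rightarrow> (nat \<Rightarrow> real \<Rightarrow> real \<Rightarrow> real^4) \<Rightarrow>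
   (nat \<Rightarrow> real \<Rightarrow> real \<Rightarrow> real) \<Rightarrow> real \<Rightarrow> real \<Rightarrow> real" where
  "ellipse_Delta \<Psi> p k s t = 1 / 4 * det (vector
     [vector [h11 \<Psi> p k 1 s t, 2 * h12 \<Psi> p k 1 s t, h22 \<Psi> p k 1 s t, 0],
      vector [h11 \<Psi> p k 2 s t, 2 * h12 \<Psi> p k 2 s t, h22 \<Psi> p k 2 s t, 0],
      vector [0, h11 \<Psi> p k 1 s t, 2 * h12 \<Psi> p k 1 s t, h22 \<Psi> p k 1 s t],
      vector [0, h11 \<Psi> p k 2 s t, 2 * h12 \<Psi> p k 2 s t, h22 \<Psi> p k 2 s t]] :: real^4^4)"

definition matrix_A ::
  "(real \<Rightarrow> real \<Rightarrow> real^4) \<Rightarrow> (nat \<Rightarrow> real \<Rightarrow> real \<Rightarrow> real^4) \<Rightarrow>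
   (nat \<Rightarrow> real \<Rightarrow> real \<Rightarrow> real) \<Rightarrow> real \<Rightarrow> real \<Rightarrow> real^3^2" where
  "matrix_A \<Psi> p k s t = vector
     [vector [h11 \<Psi> p k 1 s t, h12 \<Psi> p k 1 s t, h22 \<Psi> p k 1 s t],
      vector [h11 \<Psi> p k 2 s t, h12 \<Psi> p k 2 s t, h22 \<Psi> p k 2 s t]]"

(* The position of the origin of the normal space relative to the curvature ellipse is, by
   convention, the sign of Delta (also when the ellipse degenerates), and hyperbolic, elliptic
   and parabolic points are named after it. *)
definition origin_outside_ellipse ::
  "(real \<Rightarrow> real \<Rightarrow> real^4) \<Rightarrow> (nat \<Rightarrow> real \<Rightarrow> real \<Rightarrow> real^4) \<Rightarrow>
   (nat \<Rightarrow> real \<Rightarrow> real \<Rightarrow> real) \<Rightarrow> real \<Rightarrow> real \<Rightarrow> bool" where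
  "origin_outside_ellipse \<Psi> p k s t \<longleftrightarrow> ellipse_Delta \<Psi> p k s t < 0"

definition origin_inside_ellipse ::
  "(real \<Rightarrow> real \<Rightarrow> real^4) \<Rightarrow> (nat \<Rightarrow> real \<Rightarrow> real \<Rightarrow> real^4) \<Rightarrow>
   (nat \<Rightarrow> real \<Rightarrow> real \<Rightarrow> real) \<Rightarrow> real \<Rightarrow> real \<Rightarrow> bool" where
  "origin_inside_ellipse \<Psi> p k s t \<longleftrightarrow> ellipse_Delta \<Psi> p k s t > 0"

definition origin_on_ellipse ::
  "(real \<Rightarrow> real \<Rightarrow> real^4) \<Rightarrow> (nat \<Rightarrow> real \<Rightarrow> real \<Rightarrow> real^4) \<Rightarrow>
   (nat \<Rightarrow> real \<Rightarrow> real \<Rightarrow> real) \<Rightarrow> real \<Rightarrow> real \<Rightarrow> bool" where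
  "origin_on_ellipse \<Psi> p k s t \<longleftrightarrow> ellipse_Delta \<Psi> p k s t = 0"

definition hyperbolic_point ::
  "(real \<Rightarrow> real \<Rightarrow> real^4) \<Rightarrow> (nat \<Rightarrow> real \<Rightarrow> real \<Rightarrow> real^4) \<Rightarrow>
   (nat \<Rightarrow> real \<Rightarrow> real \<Rightarrow> real) \<Rightarrow> real \<Rightarrow> real \<Rightarrow> bool" where
  "hyperbolic_point \<Psi> p k s t \<longleftrightarrow> ellipse_Delta \<Psi> p k s t < 0"

definition elliptic_point ::
  "(real \<Rightarrow> real \<Rightarrow> real^4) \<Rightarrow> (nat \<Rightarrow> real \<Rightarrow> real \<Rightarrow> real^4) \<Rightarrow>
   (nat \<Rightarrow> real \<Rightarrow> real \<Rightarrow> real) \<Rightarrow> real \<Rightarrow> real \<Rightarrow> bool" where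
  "elliptic_point \<Psi> p k s t \<longleftrightarrow> ellipse_Delta \<Psi> p k s t > 0"

definition parabolic_point ::
  "(real \<Rightarrow> real \<Rightarrow> real^4) \<Rightarrow> (nat \<Rightarrow> real \<Rightarrow> real \<Rightarrow> real^4) \<Rightarrow>
   (nat \<Rightarrow> real \<Rightarrow> real \<Rightarrow> real) \<Rightarrow> real \<Rightarrow> real \<Rightarrow> bool" where
  "parabolic_point \<Psi> p k s t \<longleftrightarrow> ellipse_Delta \<Psi> p k s t = 0"

definition inflection_imaginary_type ::
  "(real \<Rightarrow> real \<Rightarrow> real^4) \<Rightarrow> (nat \<Rightarrow> real \<Rightarrow> real \<Rightarrow> real^4) \<Rightarrow>
   (nat \<Rightarrow> real \<Rightarrow> real \<Rightarrow> real) \<Rightarrow> real \<Rightarrow> real \<Rightarrow> bool" where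
  "inflection_imaginary_type \<Psi> p k s t \<longleftrightarrow>
     ellipse_Delta \<Psi> p k s t = 0 \<and> Gaussian_K \<Psi> p k s t > 0"

definition inflection_flat_type ::
  "(real \<Rightarrow> real \<Rightarrow> real^4) \<Rightarrow> (nat \<Rightarrow> real \<Rightarrow> real \<Rightarrow> real^4) \<Rightarrow>
   (nat \<Rightarrow> real \<Rightarrow> real \<Rightarrow> real) \<Rightarrow> real \<Rightarrow> real \<Rightarrow> bool" where
  "inflection_flat_type \<Psi> p k s t \<longleftrightarrow>
     ellipse_Delta \<Psi> p k s t = 0 \<and> Gaussian_K \<Psi> p k s t = 0"

definition ellipse_nondegenerate ::
  "(real \<Rightarrow> real \<Rightarrow> real^4) \<Rightarrow> (nat \<Rightarrow> real \<Rightarrow> real \<Rightarrow> real^4) \<Rightarrow>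
   (nat \<Rightarrow> real \<Rightarrow> real \<Rightarrow> real) \<Rightarrow> real \<Rightarrow> real \<Rightarrow> bool" where
  "ellipse_nondegenerate \<Psi> p k s t \<longleftrightarrow>
     ellipse_Delta \<Psi> p k s t = 0 \<and> Gaussian_K \<Psi> p k s t < 0 \<and> rank (matrix_A \<Psi> p k s t) = 2"

end

theory Submission
  imports Defs
begin

text \<open>
  In the parallel transport frame the Betchov-Da Rios equation reads
  \<open>\<Psi>\<^sub>t = P P\<^sub>1 + R P\<^sub>2 + S P\<^sub>3\<close>, since \<open>(P, R, S) = - k \<times> k\<^sub>s\<close> as a vector of \<open>\<real>\<^sup>3\<close>.
  Differentiating this once more, with \<open>\<Psi>\<^sub>s\<^sub>t = \<Psi>\<^sub>t\<^sub>s\<close> by Schwarz and the relations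
  \<open>k \<bullet> (P, R, S) = k\<^sub>s \<bullet> (P, R, S) = 0\<close>, gives the second fundamental forms
  \<open>h\<^sup>1 = (Q, 0, A / (Q W\<^sup>2))\<close> and \<open>h\<^sup>2 = (0, Q C / W\<^sup>2, B / (Q W\<^sup>3))\<close>.  Hence
  \<open>\<Delta> = - (B\<^sup>2 + 4 Q\<^sup>2 A C\<^sup>2) / (4 W\<^sup>6)\<close> and \<open>K = A / W\<^sup>2 - (Q C / W\<^sup>2)\<^sup>2\<close>, while the
  \<open>2 \<times> 3\<close> matrix of the forms has rank 2 unless \<open>B = C = 0\<close>.
\<close>

subsection \<open>Determinants and orthonormal frames in dimension four\<close>

lemma vector_4:
  "(vector [a, b, c, d] :: ('a::zero)^4) $ 1 = a"
  "(vector [a, b, c, d] :: ('a::zero)^4) $ 2 = b"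
  "(vector [a, b, c, d] :: ('a::zero)^4) $ 3 = c"
  "(vector [a, b, c, d] :: ('a::zero)^4) $ 4 = d"
  unfolding vector_def by simp_all

text \<open>Laplace expansion along the first row. The sum over all permutations is unfolded by
  splitting off the indices 1, 2, 3 in turn, until only permutations of \<open>{4}\<close>
  remain.\<close>

lemma det_4:
  "det (A :: 'a::comm_ring_1^4^4) =
     A$1$1 * (A$2$2 * (A$3$3 * A$4$4 - A$3$4 * A$4$3) - A$2$3 * (A$3$2 * A$4$4 - A$3$4 * A$4$2)
              + A$2$4 * (A$3$2 * A$4$3 - A$3$3 * A$4$2))
   - A$1$2 * (A$2$1 * (A$3$3 * A$4$4 - A$3$4 * A$4$3) - A$2$3 * (A$3$1 * A$4$4 - A$3$4 * A$4$1)
              + A$2$4 * (A$3$1 * A$4$3 - A$3$3 * A$4$1))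
   + A$1$3 * (A$2$1 * (A$3$2 * A$4$4 - A$3$4 * A$4$2) - A$2$2 * (A$3$1 * A$4$4 - A$3$4 * A$4$1)
              + A$2$4 * (A$3$1 * A$4$2 - A$3$2 * A$4$1))
   - A$1$4 * (A$2$1 * (A$3$2 * A$4$3 - A$3$3 * A$4$2) - A$2$2 * (A$3$1 * A$4$3 - A$3$3 * A$4$1)
              + A$2$3 * (A$3$1 * A$4$2 - A$3$2 * A$4$1))"
proof -
  have f1: "finite {2::4, 3, 4}" "1 \<notin> {2::4, 3, 4}" by auto
  have f2: "finite {3::4, 4}" "2 \<notin> {3::4, 4}" by auto
  have f3: "finite {4::4}" "3 \<notin> {4::4}" by auto
  show ?thesis
    unfolding det_def UNIV_4
    unfolding sum_over_permutations_insert[OF f1]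
    unfolding sum_over_permutations_insert[OF f2]
    unfolding sum_over_permutations_insert[OF f3]
    unfolding permutes_sing
    by (simp add: sign_swap_id permutation_swap_id sign_compose permutation_compose sign_id swap_id_eq
        algebra_simps)
qed

text \<open>Passing to frame coordinates multiplies on the right by the transpose of the frame
  matrix. Orthogonality leaves 1 or -1 for its determinant, and positive orientation selects
  1.\<close>

lemma orthonormal_frame_det:
  fixes T p1 p2 p3 :: "real^4"
  assumes on: "orthogonal_matrix (vector [T, p1, p2, p3] :: real^4^4)"
    and pos: "det (vector [T, p1, p2, p3] :: real^4^4) > 0"
  shows "det (vector [w, x, y, z] :: real^4^4) =
    det (vector [vector [w \<bullet> T, w \<bullet> p1, w \<bullet> p2, w \<bullet> p3],
                 vector [x \<bullet> T, x \<bullet> p1, x \<bullet> p2, x \<bullet> p3],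
                 vector [y \<bullet> T, y \<bullet> p1, y \<bullet> p2, y \<bullet> p3],
                 vector [z \<bullet> T, z \<bullet> p1, z \<bullet> p2, z \<bullet> p3]] :: real^4^4)" (is "det ?V = det ?M")
proof -
  let ?F = "vector [T, p1, p2, p3] :: real^4^4"
  have F1: "det ?F = 1"
    using det_orthogonal_matrix[OF on] pos by auto
  have "?M = ?V ** transpose ?F"
    by (simp add: vec_eq_iff forall_4 matrix_matrix_mult_def transpose_def vector_4 inner_vec_def)
  then have "det ?M = det ?V * det ?F"
    by (simp add: det_mul)
  with F1 show ?thesis by simp
qed

lemma orthonormal_frame_matrix:
  fixes T p1 p2 p3 :: "real^4"
  assumes "T \<bullet> T = 1" "p1 \<bullet> p1 = 1" "p2 \<bullet> p2 = 1" "p3 \<bullet> p3 = 1"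
    and "T \<bullet> p1 = 0" "T \<bullet> p2 = 0" "T \<bullet> p3 = 0" "p1 \<bullet> p2 = 0" "p1 \<bullet> p3 = 0" "p2 \<bullet> p3 = 0"
  shows "orthogonal_matrix (vector [T, p1, p2, p3] :: real^4^4)"
  unfolding orthogonal_matrix_orthonormal_rows
  using assms
  by (simp add: forall_4 row_def vector_4 orthogonal_def norm_eq_sqrt_inner inner_commute)

text \<open>The vector \<open>?F *v v\<close> lists the frame components of \<open>v\<close>, and
  the transpose, being the inverse, recombines them.\<close>

lemma orthonormal_frame_expansion:
  fixes T p1 p2 p3 :: "real^4"
  assumes "orthogonal_matrix (vector [T, p1, p2, p3] :: real^4^4)"
  shows "v = (v \<bullet> T) *\<^sub>R T + (v \<bullet> p1) *\<^sub>R p1 + (v \<bullet> p2) *\<^sub>R p2 + (v \<bullet> p3) *\<^sub>R p3"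
proof -
  let ?F = "vector [T, p1, p2, p3] :: real^4^4"
  have "v = transpose ?F *v (?F *v v)"
    using assms unfolding orthogonal_matrix by (simp add: matrix_vector_mul_assoc)
  also have "\<dots> = (v \<bullet> T) *\<^sub>R T + (v \<bullet> p1) *\<^sub>R p1 + (v \<bullet> p2) *\<^sub>R p2 + (v \<bullet> p3) *\<^sub>R p3"
    by (simp add: vec_eq_iff matrix_vector_mult_def sum_4 transpose_def vector_4 inner_vec_def mult_ac)
  finally show ?thesis .
qed

text \<open>The determinant is linear in its first row, so \<open>w\<close> takes the place of the
  formal row of basis vectors.\<close>

lemma inner_cross4: "w \<bullet> cross4 x y z = det (vector [w, x, y, z] :: real^4^4)"
  by (simp add: cross4_def inner_vec_def sum_4 det_4 vector_4 axis_def algebra_simps)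

text \<open>In frame coordinates \<open>T\<close> is the row (1, 0, 0, 0), so tangential components
  of \<open>y\<close> and \<open>z\<close> drop out. What remains is the three-dimensional cross
  product of the normal parts, in the order \<open>z\<close>, \<open>y\<close> because the row of
  \<open>T\<close> stands second.\<close>

lemma cross4_frame:
  fixes T p1 p2 p3 :: "real^4"
  assumes on: "orthogonal_matrix (vector [T, p1, p2, p3] :: real^4^4)"
    and pos: "det (vector [T, p1, p2, p3] :: real^4^4) > 0"
    and T: "T \<bullet> T = 1" "T \<bullet> p1 = 0" "T \<bullet> p2 = 0" "T \<bullet> p3 = 0"
    and frame: "p1 \<bullet> p1 = 1" "p2 \<bullet> p2 = 1" "p3 \<bullet> p3 = 1" "p1 \<bullet> p2 = 0" "p1 \<bullet> p3 = 0" "p2 \<bullet> p3 = 0"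
  shows "cross4 T y z =
    ((y \<bullet> p3) * (z \<bullet> p2) - (y \<bullet> p2) * (z \<bullet> p3)) *\<^sub>R p1
    + ((y \<bullet> p1) * (z \<bullet> p3) - (y \<bullet> p3) * (z \<bullet> p1)) *\<^sub>R p2
    + ((y \<bullet> p2) * (z \<bullet> p1) - (y \<bullet> p1) * (z \<bullet> p2)) *\<^sub>R p3"
proof -
  have c: "cross4 T y z \<bullet> w = det (vector [vector [w \<bullet> T, w \<bullet> p1, w \<bullet> p2, w \<bullet> p3],
                 vector [T \<bullet> T, T \<bullet> p1, T \<bullet> p2, T \<bullet> p3],
                 vector [y \<bullet> T, y \<bullet> p1, y \<bullet> p2, y \<bullet> p3],
                 vector [z \<bullet> T, z \<bullet> p1, z \<bullet> p2, z \<bullet> p3]] :: real^4^4)" for w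
    using orthonormal_frame_det[OF on pos, of w T y z]
    by (simp only: inner_cross4 inner_commute[of _ w])
  let ?v = "cross4 T y z"
  have frame': "p2 \<bullet> p1 = 0" "p3 \<bullet> p1 = 0" "p3 \<bullet> p2 = 0" "p1 \<bullet> T = 0" "p2 \<bullet> T = 0" "p3 \<bullet> T = 0"
    using T frame by (simp_all add: inner_commute)
  note simps = c det_4 vector_4 T frame frame'
  have "?v \<bullet> T = 0"
    "?v \<bullet> p1 = (y \<bullet> p3) * (z \<bullet> p2) - (y \<bullet> p2) * (z \<bullet> p3)"
    "?v \<bullet> p2 = (y \<bullet> p1) * (z \<bullet> p3) - (y \<bullet> p3) * (z \<bullet> p1)"
    "?v \<bullet> p3 = (y \<bullet> p2) * (z \<bullet> p1) - (y \<bullet> p1) * (z \<bullet> p2)"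
    by (simp_all add: simps)
  with orthonormal_frame_expansion[OF on, of ?v] show ?thesis
    by simp
qed

lemma rank_2_matrix:
  fixes a b c d :: real
  assumes "a \<noteq> 0" "b \<noteq> 0 \<or> d \<noteq> 0"
  shows "rank (vector [vector [a, 0, c], vector [0, b, d]] :: real^3^2) = 2"
proof -
  let ?A = "vector [vector [a, 0, c], vector [0, b, d]] :: real^3^2"
  have "\<exists>x. y = ?A *v x" for y
  proof (cases "b = 0")
    case True
    with assms show ?thesis
      \<comment> \<open>Here \<open>d\<close> is nonzero: the second row determines the third
        coordinate, and then the first row determines the first one.\<close>
      by (intro exI[of _ "vector [(y$1 - c * (y$2 / d)) / a, 0, y$2 / d]"])
        (simp add: vec_eq_iff forall_2 matrix_vector_mult_def sum_3)
  next
    case False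
    with assms show ?thesis
      by (intro exI[of _ "vector [y$1 / a, y$2 / b, 0]"])
        (simp add: vec_eq_iff forall_2 matrix_vector_mult_def sum_3)
  qed
  then have "surj ((*v) ?A)"
    by (auto simp: surj_def)
  then show ?thesis
    using full_rank_surjective[of ?A] by simp
qed

subsection \<open>Partial derivatives of smooth maps\<close>

text \<open>Derivatives are local, so on an open set smoothness depends only on the values there.
  This carries smoothness over from Frechet derivatives to \<open>D_s\<close> and
  \<open>D_t\<close>, which are compared with them only on the domain.\<close>

lemma C_k_on_cong:
  assumes "open U" "\<And>x. x \<in> U \<Longrightarrow> f x = g x" "C_k_on n U f"
  shows "C_k_on n U g"
  using assms(2,3)
proof (induction n arbitrary: f g)
  case 0
  then show ?case by (metis C_k_on.simps(1) continuous_on_cong)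
next
  case (Suc n)
  have diff: "f differentiable (at x)" if "x \<in> U" for x
    using Suc.prems that by simp
  have "g differentiable (at x)" if "x \<in> U" for x
    using diff[OF that] Suc.prems(1) assms(1) that
    by (metis differentiable_def has_derivative_transform_within_open)
  moreover have "C_k_on n U (\<lambda>x. frechet_derivative g (at x) v)" for v
  proof (rule Suc.IH)
    show "C_k_on n U (\<lambda>x. frechet_derivative f (at x) v)"
      using Suc.prems(2) by simp
    show "frechet_derivative f (at x) v = frechet_derivative g (at x) v" if "x \<in> U" for x
      using frechet_derivative_transform_within_open[OF diff[OF that] assms(1) that Suc.prems(1)]
      by simp
  qed
  ultimately show ?case by simp
qed

lemma smooth_on_cong:
  "open U \<Longrightarrow> (\<And>x. x \<in> U \<Longrightarrow> f x = g x) \<Longrightarrow> smooth_on U f \<Longrightarrow> smooth_on U g"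
  unfolding smooth_on_def using C_k_on_cong by blast

lemma smooth_on_differentiable: "smooth_on U f \<Longrightarrow> x \<in> U \<Longrightarrow> f differentiable (at x)"
  unfolding smooth_on_def using C_k_on.simps(2)[of 0 U f] by blast

lemma smooth_on_continuous_on: "smooth_on U f \<Longrightarrow> continuous_on U f"
  unfolding smooth_on_def using C_k_on.simps(1)[of U f] by blast

lemma smooth_on_frechet_derivative:
  "smooth_on U f \<Longrightarrow> smooth_on U (\<lambda>x. frechet_derivative f (at x) v)"
  unfolding smooth_on_def by (metis C_k_on.simps(2))

text \<open>Chain rule along the two coordinate lines through \<open>(s, t)\<close>. Under total
  differentiability \<open>D_s\<close> and \<open>D_t\<close> are thus true derivatives and not
  unspecified values of \<open>vector_derivative\<close>.\<close>

lemma partial_derivatives: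
  assumes "(\<lambda>(s, t). F s t) differentiable (at (s, t))"
  shows has_vector_derivative_D_s: "((\<lambda>u. F u t) has_vector_derivative D_s F s t) (at s)"
    and has_vector_derivative_D_t: "((\<lambda>u. F s u) has_vector_derivative D_t F s t) (at t)"
    and D_s_eq_frechet_derivative:
      "D_s F s t = frechet_derivative (\<lambda>(s, t). F s t) (at (s, t)) (1, 0)"
    and D_t_eq_frechet_derivative:
      "D_t F s t = frechet_derivative (\<lambda>(s, t). F s t) (at (s, t)) (0, 1)"
proof -
  let ?f = "\<lambda>(s, t). F s t"
  let ?d = "frechet_derivative ?f (at (s, t))"
  have d: "(?f has_derivative ?d) (at (s, t))"
    using assms by (simp add: frechet_derivative_works)
  then have lin: "linear ?d"
    by (rule has_derivative_linear)
  have "((\<lambda>u. (u, t)) has_derivative (\<lambda>h. (h, 0))) (at s)"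
    by (auto intro!: derivative_eq_intros)
  from has_derivative_compose[OF this d]
  have "((\<lambda>u. F u t) has_derivative (\<lambda>h. ?d (h, 0))) (at s)" by simp
  moreover have "?d (h, 0) = h *\<^sub>R ?d (1, 0)" for h
    using linear_cmul[OF lin, of h "(1, 0)"] by simp
  then have "(\<lambda>h. ?d (h, 0)) = (\<lambda>h. h *\<^sub>R ?d (1, 0))"
    by (rule ext)
  ultimately have s: "((\<lambda>u. F u t) has_vector_derivative ?d (1, 0)) (at s)"
    by (simp only: has_vector_derivative_def)
  have "((\<lambda>u. (s, u)) has_derivative (\<lambda>h. (0, h))) (at t)"
    by (auto intro!: derivative_eq_intros)
  from has_derivative_compose[OF this d]
  have "((\<lambda>u. F s u) has_derivative (\<lambda>h. ?d (0, h))) (at t)" by simp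
  moreover have "?d (0, h) = h *\<^sub>R ?d (0, 1)" for h
    using linear_cmul[OF lin, of h "(0, 1)"] by simp
  then have "(\<lambda>h. ?d (0, h)) = (\<lambda>h. h *\<^sub>R ?d (0, 1))"
    by (rule ext)
  ultimately have t: "((\<lambda>u. F s u) has_vector_derivative ?d (0, 1)) (at t)"
    by (simp only: has_vector_derivative_def)
  show Ds: "D_s F s t = ?d (1, 0)" and Dt: "D_t F s t = ?d (0, 1)"
    using s t by (simp_all add: D_s_def D_t_def vector_derivative_at)
  show "((\<lambda>u. F u t) has_vector_derivative D_s F s t) (at s)"
    "((\<lambda>u. F s u) has_vector_derivative D_t F s t) (at t)"
    using s t Ds Dt by simp_all
qed

lemma smooth_on_D_s:
  assumes "open U" "smooth_on U (\<lambda>(s, t). F s t)"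
  shows "smooth_on U (\<lambda>(s, t). D_s F s t)"
proof (rule smooth_on_cong[OF assms(1) _ smooth_on_frechet_derivative[OF assms(2), of "(1, 0)"]])
  fix x assume "x \<in> U"
  then show "frechet_derivative (\<lambda>(s, t). F s t) (at x) (1, 0) = (case x of (s, t) \<Rightarrow> D_s F s t)"
    using D_s_eq_frechet_derivative smooth_on_differentiable[OF assms(2)] by (cases x) force
qed

lemma smooth_on_D_t:
  assumes "open U" "smooth_on U (\<lambda>(s, t). F s t)"
  shows "smooth_on U (\<lambda>(s, t). D_t F s t)"
proof (rule smooth_on_cong[OF assms(1) _ smooth_on_frechet_derivative[OF assms(2), of "(0, 1)"]])
  fix x assume "x \<in> U"
  then show "frechet_derivative (\<lambda>(s, t). F s t) (at x) (0, 1) = (case x of (s, t) \<Rightarrow> D_t F s t)"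
    using D_t_eq_frechet_derivative smooth_on_differentiable[OF assms(2)] by (cases x) force
qed

text \<open>The derivative sees only values near \<open>s\<close>, so a formula for \<open>F\<close>
  valid on \<open>I\<close> may be differentiated in its place. The frame identities, known only on
  the domain, are differentiated in this way.\<close>

lemma D_s_eqI:
  assumes "open I" "s \<in> I" "\<And>u. u \<in> I \<Longrightarrow> F u t = g u" "(g has_vector_derivative d) (at s)"
  shows "D_s F s t = d"
proof -
  have "((\<lambda>u. F u t) has_vector_derivative d) (at s)"
    using has_vector_derivative_transform_within_open[OF assms(4,1,2)] assms(3) by simp
  then show ?thesis by (simp add: D_s_def vector_derivative_at)
qed

lemma D_t_eqI:
  assumes "open J" "t \<in> J" "\<And>u. u \<in> J \<Longrightarrow> F s u = g u" "(g has_vector_derivative d) (at t)"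
  shows "D_t F s t = d"
proof -
  have "((\<lambda>u. F s u) has_vector_derivative d) (at t)"
    using has_vector_derivative_transform_within_open[OF assms(4,1,2)] assms(3) by simp
  then show ?thesis by (simp add: D_t_def vector_derivative_at)
qed

text \<open>Schwarz's theorem: differentiate \<open>F u t = F a t + \<integral>\<^sub>a\<^sup>u D_s F x t dx\<close> under the integral sign in
  \<open>t\<close>, then apply the fundamental theorem of calculus in \<open>u\<close>.\<close>

lemma D_t_D_s_commute:
  fixes F :: "real \<Rightarrow> real \<Rightarrow> 'a::banach"
  assumes I: "open I" and J: "open J" "is_interval J"
    and F: "smooth_on (I \<times> J) (\<lambda>(s, t). F s t)" and s: "s \<in> I" and t: "t \<in> J"
  shows "D_t (D_s F) s t = D_s (D_t F) s t"
proof -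
  have IJ: "open (I \<times> J)" using I J by (simp add: open_Times)
  obtain e where e: "e > 0" "cball s e \<subseteq> I"
    using I s open_contains_cball by blast
  \<comment> \<open>Integration starts to the left of \<open>s\<close>, at \<open>a\<close>, so that
    one formula covers \<open>u\<close> on both sides of \<open>s\<close>.\<close>
  define a b where "a = s - e" and "b = s + e"
  have ab: "{a..b} \<subseteq> I"
    using e by (auto simp: a_def b_def cball_eq_atLeastAtMost)
  have s_ab: "s \<in> {a<..<b}" using e by (auto simp: a_def b_def)
  note FD = smooth_on_differentiable[OF F]
  have G: "smooth_on (I \<times> J) (\<lambda>(s, t). D_s F s t)" by (rule smooth_on_D_s[OF IJ F])
  note GD = smooth_on_differentiable[OF G]
  have contG: "continuous_on {a..b} (\<lambda>x. D_s F x y)" if "y \<in> J" for y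
    using ab that
    by (intro continuous_on_compose2[OF smooth_on_continuous_on[OF G], of _ "\<lambda>x. (x, y)", simplified])
      (auto intro!: continuous_intros)
  have H: "smooth_on (I \<times> J) (\<lambda>(s, t). D_t (D_s F) s t)" by (rule smooth_on_D_t[OF IJ G])
  have contH: "continuous_on {a..b} (\<lambda>x. D_t (D_s F) x t)"
    using ab t
    by (intro continuous_on_compose2[OF smooth_on_continuous_on[OF H], of _ "\<lambda>x. (x, t)", simplified])
      (auto intro!: continuous_intros)
  have FTC: "F u y = F a y + integral {a..u} (\<lambda>x. D_s F x y)" if "u \<in> {a..b}" "y \<in> J" for u y
  proof -
    have "((\<lambda>x. D_s F x y) has_integral (F u y - F a y)) {a..u}"
    proof (rule fundamental_theorem_of_calculus)
      show "a \<le> u" using that by simp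
      fix x assume "x \<in> {a..u}"
      then have "(x, y) \<in> I \<times> J" using that ab by auto
      then show "((\<lambda>u. F u y) has_vector_derivative D_s F x y) (at x within {a..u})"
        by (rule has_vector_derivative_at_within[OF has_vector_derivative_D_s[OF FD]])
    qed
    then show ?thesis by (simp add: integral_unique)
  qed
  have Leibniz: "D_t F u t = D_t F a t + integral {a..u} (\<lambda>x. D_t (D_s F) x t)" if u: "u \<in> {a..b}" for u
  proof (rule D_t_eqI[where F = F and s = u
        and g = "\<lambda>y. F a y + integral {a..u} (\<lambda>x. D_s F x y)", OF J(1) t FTC[OF u]])
    have aI: "(a, t) \<in> I \<times> J" using ab s_ab t by auto
    have "((\<lambda>y. integral (cbox a u) (\<lambda>x. D_s F x y)) has_vector_derivative
        integral (cbox a u) (\<lambda>x. D_t (D_s F) x t)) (at t within J)"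
    proof (rule leibniz_rule_vector_derivative)
      show "convex J" using J(2) by (simp add: is_interval_convex)
      show "t \<in> J" by (rule t)
      show "(\<lambda>x. D_s F x y) integrable_on cbox a u" if "y \<in> J" for y
        using u integrable_continuous_real[OF continuous_on_subset[OF contG[OF that], of "{a..u}"]]
        by simp
      show "((\<lambda>y. D_s F x y) has_vector_derivative D_t (D_s F) x y) (at y within J)"
        if "y \<in> J" "x \<in> cbox a u" for y x
      proof -
        have "(x, y) \<in> I \<times> J" using that u ab by auto
        then show ?thesis
          by (rule has_vector_derivative_at_within[OF has_vector_derivative_D_t[OF GD]])
      qed
      \<comment> \<open>The Leibniz rule takes the parameter first and the integration variable
        second, hence the swap of coordinates.\<close>
      have "continuous_on (J \<times> cbox a u) (\<lambda>z. (\<lambda>(s, t). D_t (D_s F) s t) (snd z, fst z))"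
      proof (rule continuous_on_compose2[OF smooth_on_continuous_on[OF H], where f = "\<lambda>z. (snd z, fst z)"])
        show "continuous_on (J \<times> cbox a u) (\<lambda>z. (snd z, fst z))"
          by (intro continuous_on_Pair continuous_on_snd continuous_on_fst continuous_on_id)
        show "(\<lambda>z. (snd z, fst z)) ` (J \<times> cbox a u) \<subseteq> I \<times> J"
          using u ab by force
      qed
      then show "continuous_on (J \<times> cbox a u) (\<lambda>(y, x). D_t (D_s F) x y)"
        by (simp add: case_prod_unfold)
    qed
    then have "((\<lambda>y. integral {a..u} (\<lambda>x. D_s F x y)) has_vector_derivative
        integral {a..u} (\<lambda>x. D_t (D_s F) x t)) (at t)"
      unfolding at_within_open[OF t J(1)] interval_cbox .
    then show "((\<lambda>y. F a y + integral {a..u} (\<lambda>x. D_s F x y)) has_vector_derivative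
        D_t F a t + integral {a..u} (\<lambda>x. D_t (D_s F) x t)) (at t)"
      by (rule has_vector_derivative_add[OF has_vector_derivative_D_t[where F = F, OF FD[OF aI]]])
  qed
  have "((\<lambda>u. integral {a..u} (\<lambda>x. D_t (D_s F) x t)) has_vector_derivative D_t (D_s F) s t)
      (at s within {a..b})"
    using integral_has_vector_derivative[OF contH, of s] s_ab by simp
  then have "((\<lambda>u. integral {a..u} (\<lambda>x. D_t (D_s F) x t)) has_vector_derivative D_t (D_s F) s t) (at s)"
    using s_ab by (metis at_within_Icc_at greaterThanLessThan_iff)
  from has_vector_derivative_add[OF has_vector_derivative_const[of "D_t F a t"] this]
  have deriv: "((\<lambda>u. D_t F a t + integral {a..u} (\<lambda>x. D_t (D_s F) x t)) has_vector_derivative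
      D_t (D_s F) s t) (at s)"
    by simp
  have "D_t F u t = D_t F a t + integral {a..u} (\<lambda>x. D_t (D_s F) x t)" if "u \<in> {a<..<b}" for u
    using that by (intro Leibniz) simp
  from D_s_eqI[where F = "D_t F", OF _ s_ab this deriv]
  show ?thesis by simp
qed

subsection \<open>The parallel transport frame of a solution\<close>

lemma differentiable_case_prod:
  fixes x :: "real \<times> real"
  shows differentiable_case_prod_inner:
    "(\<lambda>(s, t). F s t) differentiable (at x) \<Longrightarrow> (\<lambda>(s, t). G s t) differentiable (at x) \<Longrightarrow>
      (\<lambda>(s, t). F s t \<bullet> G s t) differentiable (at x)"
    and differentiable_case_prod_mult:
    "(\<lambda>(s, t). f s t) differentiable (at x) \<Longrightarrow> (\<lambda>(s, t). g s t) differentiable (at x) \<Longrightarrow>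
      (\<lambda>(s, t). f s t * g s t :: real) differentiable (at x)"
    and differentiable_case_prod_diff:
    "(\<lambda>(s, t). f s t) differentiable (at x) \<Longrightarrow> (\<lambda>(s, t). g s t) differentiable (at x) \<Longrightarrow>
      (\<lambda>(s, t). f s t - g s t :: real) differentiable (at x)"
  by (auto simp: case_prod_unfold differentiable_def
      intro: has_derivative_inner has_derivative_mult has_derivative_diff)

lemmas has_vector_derivative_inner =
  bounded_bilinear.has_vector_derivative[OF bounded_bilinear_inner]

lemmas has_vector_derivative_scaleR' =
  bounded_bilinear.has_vector_derivative[OF bounded_bilinear_scaleR]

locale bdr_surface =
  fixes I J :: "real set"
    and \<Psi> T :: "real \<Rightarrow> real \<Rightarrow> real^4"
    and p :: "nat \<Rightarrow> real \<Rightarrow> real \<Rightarrow> real^4"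
    and k :: "nat \<Rightarrow> real \<Rightarrow> real \<Rightarrow> real"
  assumes unit_speed: "unit_speed_map I J \<Psi>"
    and bdr: "Betchov_Da_Rios I J \<Psi>"
    and frame: "parallel_transport_frame I J \<Psi> T p k"
begin

text \<open>Keeps the simplifier from turning the index \<open>1\<close> of the families
  \<open>p\<close> and \<open>k\<close> into \<open>Suc 0\<close>, which would no longer match the
  facts about \<open>p 1\<close> and \<open>k 1\<close>.\<close>

declare One_nat_def [simp del]

lemma domain: "open I" "open J" "is_interval J" "open (I \<times> J)"
  using unit_speed by (auto simp: unit_speed_map_def open_Times)

lemma smooth_Psi: "smooth_on (I \<times> J) (\<lambda>(s, t). \<Psi> s t)"
  using unit_speed by (simp add: unit_speed_map_def)

lemmas smooth_Ds = smooth_on_D_s[OF domain(4) smooth_Psi]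
lemmas smooth_Dss = smooth_on_D_s[OF domain(4) smooth_Ds]
lemmas smooth_Dsss = smooth_on_D_s[OF domain(4) smooth_Dss]

lemma smooth_p: "i \<in> {1..3} \<Longrightarrow> smooth_on (I \<times> J) (\<lambda>(s, t). p i s t)"
  using frame by (simp add: parallel_transport_frame_def)

context
  fixes s t assumes st: "s \<in> I" "t \<in> J"
begin

lemma st_mem: "(s, t) \<in> I \<times> J"
  using st by simp

lemma frame_at:
  shows norm_T: "T s t \<bullet> T s t = 1"
    and T_p: "i \<in> {1..3} \<Longrightarrow> T s t \<bullet> p i s t = 0"
    and p_p: "i \<in> {1..3} \<Longrightarrow> j \<in> {1..3} \<Longrightarrow> p i s t \<bullet> p j s t = (if i = j then 1 else 0)"
    and frame_pos: "det (vector [T s t, p 1 s t, p 2 s t, p 3 s t] :: real^4^4) > 0"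
    and T_eq: "T s t = D_s \<Psi> s t"
    and D_s_T: "D_s T s t = k 1 s t *\<^sub>R p 1 s t + k 2 s t *\<^sub>R p 2 s t + k 3 s t *\<^sub>R p 3 s t"
    and D_s_p: "i \<in> {1..3} \<Longrightarrow> D_s (p i) s t = - (k i s t) *\<^sub>R T s t"
  using frame st unfolding parallel_transport_frame_def norm_eq_1 by blast+

lemma p_p_eqs:
  "p 1 s t \<bullet> p 1 s t = 1" "p 1 s t \<bullet> p 2 s t = 0" "p 1 s t \<bullet> p 3 s t = 0"
  "p 2 s t \<bullet> p 1 s t = 0" "p 2 s t \<bullet> p 2 s t = 1" "p 2 s t \<bullet> p 3 s t = 0"
  "p 3 s t \<bullet> p 1 s t = 0" "p 3 s t \<bullet> p 2 s t = 0" "p 3 s t \<bullet> p 3 s t = 1"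
  by (simp_all add: p_p)

lemma T_p_eqs: "T s t \<bullet> p 1 s t = 0" "T s t \<bullet> p 2 s t = 0" "T s t \<bullet> p 3 s t = 0"
  by (simp_all add: T_p)

end

section \<open>The curvatures and their derivatives as frame components of derivatives of
  \<open>\<Psi>\<close>\<close>

lemma D_ss_eq:
  assumes "s \<in> I" "t \<in> J"
  shows "D_s (D_s \<Psi>) s t = k 1 s t *\<^sub>R p 1 s t + k 2 s t *\<^sub>R p 2 s t + k 3 s t *\<^sub>R p 3 s t"
proof -
  have "D_s T s t = D_s (D_s \<Psi>) s t"
  proof (rule D_s_eqI[OF domain(1) assms(1)])
    show "T u t = D_s \<Psi> u t" if "u \<in> I" for u
      by (rule T_eq[OF that assms(2)])
    show "((\<lambda>u. D_s \<Psi> u t) has_vector_derivative D_s (D_s \<Psi>) s t) (at s)"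
      by (rule has_vector_derivative_D_s[OF smooth_on_differentiable[OF smooth_Ds st_mem[OF assms]]])
  qed
  then show ?thesis using D_s_T[OF assms] by simp
qed

lemma D_ss_p:
  assumes "s \<in> I" "t \<in> J" "i \<in> {1..3}"
  shows "D_s (D_s \<Psi>) s t \<bullet> p i s t = k i s t"
proof -
  have "i = 1 \<or> i = 2 \<or> i = 3" using assms(3) by auto
  then show ?thesis
    using p_p_eqs[OF assms(1,2)] by (auto simp: D_ss_eq[OF assms(1,2)] inner_add_left)
qed

lemma differentiable_on_cong:
  assumes "\<And>s t. s \<in> I \<Longrightarrow> t \<in> J \<Longrightarrow> F s t = G s t"
    and "(\<lambda>(s, t). F s t) differentiable (at (s, t))" "s \<in> I" "t \<in> J"
  shows "(\<lambda>(s, t). G s t) differentiable (at (s, t))"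
proof -
  obtain f' where "((\<lambda>(s, t). F s t) has_derivative f') (at (s, t))"
    using assms(2) by (auto simp: differentiable_def)
  then have "((\<lambda>(s, t). G s t) has_derivative f') (at (s, t))"
    by (rule has_derivative_transform_within_open[OF _ domain(4) st_mem[OF assms(3,4)]])
      (use assms(1) in auto)
  then show ?thesis by (rule differentiableI)
qed

text \<open>Regularity of \<open>k\<close> is not part of the frame definition; it is inherited from
  the smooth maps whose inner product is \<open>k i\<close>.\<close>

lemma differentiable_k:
  assumes "s \<in> I" "t \<in> J" "i \<in> {1..3}"
  shows "(\<lambda>(s, t). k i s t) differentiable (at (s, t))"
proof (rule differentiable_on_cong[OF _ _ assms(1,2)])
  show "D_s (D_s \<Psi>) s t \<bullet> p i s t = k i s t" if "s \<in> I" "t \<in> J" for s t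
    by (rule D_ss_p[OF that assms(3)])
  show "(\<lambda>(s, t). D_s (D_s \<Psi>) s t \<bullet> p i s t) differentiable (at (s, t))"
    by (rule differentiable_case_prod_inner[OF smooth_on_differentiable[OF smooth_Dss]
          smooth_on_differentiable[OF smooth_p[OF assms(3)]]])
      (simp_all add: assms)
qed

lemma D_s_k:
  assumes "s \<in> I" "t \<in> J" "i \<in> {1..3}"
  shows "D_s (k i) s t = D_s (D_s (D_s \<Psi>)) s t \<bullet> p i s t"
proof (rule D_s_eqI[OF domain(1) assms(1)])
  show "k i u t = D_s (D_s \<Psi>) u t \<bullet> p i u t" if "u \<in> I" for u
    by (rule D_ss_p[OF that assms(2,3), symmetric])
  note mem = st_mem[OF assms(1,2)]
  \<comment> \<open>The second term of the product rule vanishes: \<open>D_s (p i)\<close> is a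
    multiple of \<open>T\<close>, while \<open>D_s (D_s \<Psi>)\<close> is normal to
    \<open>T\<close>.\<close>
  have "D_s (D_s \<Psi>) s t \<bullet> D_s (p i) s t = 0"
    using T_p_eqs[OF assms(1,2)]
    by (simp add: D_s_p[OF assms] D_ss_eq[OF assms(1,2)] inner_add_right inner_commute[of _ "T s t"])
  with has_vector_derivative_inner[OF
      has_vector_derivative_D_s[OF smooth_on_differentiable[OF smooth_Dss mem]]
      has_vector_derivative_D_s[OF smooth_on_differentiable[OF smooth_p[OF assms(3)] mem]]]
  show "((\<lambda>u. D_s (D_s \<Psi>) u t \<bullet> p i u t) has_vector_derivative
      D_s (D_s (D_s \<Psi>)) s t \<bullet> p i s t) (at s)"
    by simp
qed

lemma differentiable_D_s_k:
  assumes "s \<in> I" "t \<in> J" "i \<in> {1..3}"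
  shows "(\<lambda>(s, t). D_s (k i) s t) differentiable (at (s, t))"
proof (rule differentiable_on_cong[OF _ _ assms(1,2)])
  show "D_s (D_s (D_s \<Psi>)) s t \<bullet> p i s t = D_s (k i) s t" if "s \<in> I" "t \<in> J" for s t
    by (rule D_s_k[OF that assms(3), symmetric])
  show "(\<lambda>(s, t). D_s (D_s (D_s \<Psi>)) s t \<bullet> p i s t) differentiable (at (s, t))"
    by (rule differentiable_case_prod_inner[OF smooth_on_differentiable[OF smooth_Dsss]
          smooth_on_differentiable[OF smooth_p[OF assms(3)]]])
      (simp_all add: assms)
qed

lemma differentiable_PRS:
  assumes "s \<in> I" "t \<in> J"
  shows "(\<lambda>(s, t). fun_P k s t) differentiable (at (s, t))"
    and "(\<lambda>(s, t). fun_R k s t) differentiable (at (s, t))"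
    and "(\<lambda>(s, t). fun_S k s t) differentiable (at (s, t))"
  unfolding fun_P_def fun_R_def fun_S_def
  by (intro differentiable_case_prod_diff differentiable_case_prod_mult
      differentiable_k differentiable_D_s_k assms; simp)+

section \<open>The remaining first and second derivatives of \<open>\<Psi>\<close> in the
  frame\<close>

lemma D_t_Psi:
  assumes "s \<in> I" "t \<in> J"
  shows "D_t \<Psi> s t = fun_P k s t *\<^sub>R p 1 s t + fun_R k s t *\<^sub>R p 2 s t + fun_S k s t *\<^sub>R p 3 s t"
proof -
  note fr = norm_T[OF assms] T_p_eqs[OF assms] p_p_eqs[OF assms]
  have on: "orthogonal_matrix (vector [T s t, p 1 s t, p 2 s t, p 3 s t] :: real^4^4)"
    by (rule orthonormal_frame_matrix) (simp_all only: fr)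
  have "D_t \<Psi> s t = cross4 (T s t) (D_s (D_s \<Psi>) s t) (D_s (D_s (D_s \<Psi>)) s t)"
    using bdr assms by (simp add: Betchov_Da_Rios_def T_eq[OF assms])
  \<comment> \<open>The normal components of the last two factors are the \<open>k i\<close> and the
    \<open>D_s (k i)\<close>.\<close>
  also have "\<dots> = fun_P k s t *\<^sub>R p 1 s t + fun_R k s t *\<^sub>R p 2 s t + fun_S k s t *\<^sub>R p 3 s t"
    by (subst cross4_frame[OF on frame_pos[OF assms]])
      (simp_all add: fr D_ss_p[OF assms] D_s_k[OF assms] fun_P_def fun_R_def fun_S_def)
  finally show ?thesis .
qed

text \<open>The frame equations control only \<open>s\<close>-derivatives of the \<open>p i\<close>,
  so the mixed derivative is computed as \<open>D_s (D_t \<Psi>)\<close>. The terms with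
  \<open>D_s (p i)\<close> are tangential and contribute nothing.\<close>

lemma D_t_D_s_Psi:
  assumes "s \<in> I" "t \<in> J"
  shows "D_t (D_s \<Psi>) s t \<bullet> p 1 s t = D_s (fun_P k) s t"
    and "D_t (D_s \<Psi>) s t \<bullet> p 2 s t = D_s (fun_R k) s t"
    and "D_t (D_s \<Psi>) s t \<bullet> p 3 s t = D_s (fun_S k) s t"
proof -
  note mem = st_mem[OF assms]
  note dp = has_vector_derivative_D_s[OF smooth_on_differentiable[OF smooth_p mem]]
  note dV = differentiable_PRS[OF assms, THEN has_vector_derivative_D_s]
  have "D_s (D_t \<Psi>) s t =
      (fun_P k s t *\<^sub>R D_s (p 1) s t + D_s (fun_P k) s t *\<^sub>R p 1 s t)
    + (fun_R k s t *\<^sub>R D_s (p 2) s t + D_s (fun_R k) s t *\<^sub>R p 2 s t)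
    + (fun_S k s t *\<^sub>R D_s (p 3) s t + D_s (fun_S k) s t *\<^sub>R p 3 s t)"
    by (rule D_s_eqI[where F = "D_t \<Psi>" and t = t
          and g = "\<lambda>u. fun_P k u t *\<^sub>R p 1 u t + fun_R k u t *\<^sub>R p 2 u t + fun_S k u t *\<^sub>R p 3 u t",
          OF domain(1) assms(1) D_t_Psi[OF _ assms(2)]])
      (assumption, (rule has_vector_derivative_add has_vector_derivative_scaleR' dV dp | simp)+)
  moreover have "D_t (D_s \<Psi>) s t = D_s (D_t \<Psi>) s t"
    by (rule D_t_D_s_commute[OF domain(1-3) smooth_Psi assms])
  ultimately show "D_t (D_s \<Psi>) s t \<bullet> p 1 s t = D_s (fun_P k) s t"
    and "D_t (D_s \<Psi>) s t \<bullet> p 2 s t = D_s (fun_R k) s t"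
    and "D_t (D_s \<Psi>) s t \<bullet> p 3 s t = D_s (fun_S k) s t"
    by (simp_all add: D_s_p[OF assms] inner_add_left inner_diff_left T_p_eqs[OF assms] p_p_eqs[OF assms])
qed

text \<open>Differentiates the constant \<open>p i \<bullet> p j\<close> in \<open>t\<close>. The
  normal part of the \<open>t\<close>-motion of the frame is therefore encoded by
  \<open>fr_a23\<close>, \<open>fr_a24\<close> and \<open>fr_a34\<close> alone.\<close>

lemma D_t_p_antisym:
  assumes "s \<in> I" "t \<in> J" "i \<in> {1..3}" "j \<in> {1..3}"
  shows "D_t (p i) s t \<bullet> p j s t = - (D_t (p j) s t \<bullet> p i s t)"
proof -
  note mem = st_mem[OF assms(1,2)]
  note dp = has_vector_derivative_D_t[OF smooth_on_differentiable[OF smooth_p mem]]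
  have "D_t (\<lambda>s t. if i = j then 1 else 0 :: real) s t =
      p i s t \<bullet> D_t (p j) s t + D_t (p i) s t \<bullet> p j s t"
    by (rule D_t_eqI[where g = "\<lambda>u. p i s u \<bullet> p j s u", OF domain(2) assms(2)])
      (use p_p[OF assms(1) _ assms(3,4)] in simp,
        rule has_vector_derivative_inner[OF dp[OF assms(3)] dp[OF assms(4)]])
  then show ?thesis
    by (simp add: D_t_def inner_commute[of "p i s t"])
qed

lemma D_t_D_t_Psi:
  assumes "s \<in> I" "t \<in> J"
  shows "D_t (D_t \<Psi>) s t \<bullet> p 1 s t =
      D_t (fun_P k) s t - fun_R k s t * fr_a23 p s t - fun_S k s t * fr_a24 p s t"
    and "D_t (D_t \<Psi>) s t \<bullet> p 2 s t =
      D_t (fun_R k) s t + fun_P k s t * fr_a23 p s t - fun_S k s t * fr_a34 p s t"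
    and "D_t (D_t \<Psi>) s t \<bullet> p 3 s t =
      D_t (fun_S k) s t + fun_P k s t * fr_a24 p s t + fun_R k s t * fr_a34 p s t"
proof -
  note mem = st_mem[OF assms]
  note dp = has_vector_derivative_D_t[OF smooth_on_differentiable[OF smooth_p mem]]
  note dV = differentiable_PRS[OF assms, THEN has_vector_derivative_D_t]
  have eq: "D_t (D_t \<Psi>) s t =
      (fun_P k s t *\<^sub>R D_t (p 1) s t + D_t (fun_P k) s t *\<^sub>R p 1 s t)
    + (fun_R k s t *\<^sub>R D_t (p 2) s t + D_t (fun_R k) s t *\<^sub>R p 2 s t)
    + (fun_S k s t *\<^sub>R D_t (p 3) s t + D_t (fun_S k) s t *\<^sub>R p 3 s t)"
    by (rule D_t_eqI[where F = "D_t \<Psi>" and s = s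
          and g = "\<lambda>u. fun_P k s u *\<^sub>R p 1 s u + fun_R k s u *\<^sub>R p 2 s u + fun_S k s u *\<^sub>R p 3 s u",
          OF domain(2) assms(2) D_t_Psi[OF assms(1)]])
      (assumption, (rule has_vector_derivative_add has_vector_derivative_scaleR' dV dp | simp)+)
  have diag: "D_t (p i) s t \<bullet> p i s t = 0" if "i \<in> {1..3}" for i
    using D_t_p_antisym[OF assms that that] by simp
  have "D_t (p 2) s t \<bullet> p 1 s t = - fr_a23 p s t" "D_t (p 3) s t \<bullet> p 1 s t = - fr_a24 p s t"
    "D_t (p 3) s t \<bullet> p 2 s t = - fr_a34 p s t"
    using D_t_p_antisym[OF assms, of 2 1] D_t_p_antisym[OF assms, of 3 1] D_t_p_antisym[OF assms, of 3 2]
    by (simp_all add: fr_a23_def fr_a24_def fr_a34_def)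
  moreover have "D_t (p 1) s t \<bullet> p 2 s t = fr_a23 p s t" "D_t (p 1) s t \<bullet> p 3 s t = fr_a24 p s t"
    "D_t (p 2) s t \<bullet> p 3 s t = fr_a34 p s t"
    by (simp_all add: fr_a23_def fr_a24_def fr_a34_def)
  ultimately show
    "D_t (D_t \<Psi>) s t \<bullet> p 1 s t =
      D_t (fun_P k) s t - fun_R k s t * fr_a23 p s t - fun_S k s t * fr_a24 p s t"
    "D_t (D_t \<Psi>) s t \<bullet> p 2 s t =
      D_t (fun_R k) s t + fun_P k s t * fr_a23 p s t - fun_S k s t * fr_a34 p s t"
    "D_t (D_t \<Psi>) s t \<bullet> p 3 s t =
      D_t (fun_S k) s t + fun_P k s t * fr_a24 p s t + fun_R k s t * fr_a34 p s t"
    by (simp_all add: eq inner_add_left p_p_eqs[OF assms] diag)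
qed

section \<open>Orthogonality relations between the curvature vector and (P, R, S)\<close>

lemma k_orthogonal_PRS: "k 1 s t * fun_P k s t + k 2 s t * fun_R k s t + k 3 s t * fun_S k s t = 0"
  by (simp add: fun_P_def fun_R_def fun_S_def algebra_simps)

lemma D_s_k_orthogonal_PRS:
  "D_s (k 1) s t * fun_P k s t + D_s (k 2) s t * fun_R k s t + D_s (k 3) s t * fun_S k s t = 0"
  by (simp add: fun_P_def fun_R_def fun_S_def algebra_simps)

text \<open>Both follow by differentiating \<open>k_orthogonal_PRS\<close>. In the \<open>s\<close>
  direction the terms with derivatives of \<open>k\<close> cancel by
  \<open>D_s_k_orthogonal_PRS\<close>; in the \<open>t\<close> direction they survive and become the
  \<open>D_t (k i)\<close> terms of \<open>fun_A\<close>.\<close>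

lemma k_PRS_derivatives:
  assumes "s \<in> I" "t \<in> J"
  shows "k 1 s t * D_s (fun_P k) s t + k 2 s t * D_s (fun_R k) s t + k 3 s t * D_s (fun_S k) s t = 0"
    and "k 1 s t * D_t (fun_P k) s t + k 2 s t * D_t (fun_R k) s t + k 3 s t * D_t (fun_S k) s t =
      - (D_t (k 1) s t * fun_P k s t + D_t (k 2) s t * fun_R k s t + D_t (k 3) s t * fun_S k s t)"
proof -
  let ?g = "\<lambda>s t. k 1 s t * fun_P k s t + k 2 s t * fun_R k s t + k 3 s t * fun_S k s t"
  note ks = differentiable_k[OF assms, THEN has_vector_derivative_D_s]
  note kt = differentiable_k[OF assms, THEN has_vector_derivative_D_t]
  note Vs = differentiable_PRS[OF assms, THEN has_vector_derivative_D_s]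
  note Vt = differentiable_PRS[OF assms, THEN has_vector_derivative_D_t]
  have "D_s (\<lambda>s t. 0 :: real) s t =
      (k 1 s t * D_s (fun_P k) s t + D_s (k 1) s t * fun_P k s t)
    + (k 2 s t * D_s (fun_R k) s t + D_s (k 2) s t * fun_R k s t)
    + (k 3 s t * D_s (fun_S k) s t + D_s (k 3) s t * fun_S k s t)"
    by (rule D_s_eqI[where F = "\<lambda>s t. 0" and t = t and g = "\<lambda>u. ?g u t",
          OF domain(1) assms(1) k_orthogonal_PRS[symmetric]])
      ((rule has_vector_derivative_add has_vector_derivative_mult ks Vs | simp)+)
  then show "k 1 s t * D_s (fun_P k) s t + k 2 s t * D_s (fun_R k) s t + k 3 s t * D_s (fun_S k) s t = 0"
    using D_s_k_orthogonal_PRS[of s t] by (simp add: D_s_def)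
  have "D_t (\<lambda>s t. 0 :: real) s t =
      (k 1 s t * D_t (fun_P k) s t + D_t (k 1) s t * fun_P k s t)
    + (k 2 s t * D_t (fun_R k) s t + D_t (k 2) s t * fun_R k s t)
    + (k 3 s t * D_t (fun_S k) s t + D_t (k 3) s t * fun_S k s t)"
    by (rule D_t_eqI[where F = "\<lambda>s t. 0" and s = s and g = "\<lambda>u. ?g s u",
          OF domain(2) assms(2) k_orthogonal_PRS[symmetric]])
      ((rule has_vector_derivative_add has_vector_derivative_mult kt Vt | simp)+)
  then show "k 1 s t * D_t (fun_P k) s t + k 2 s t * D_t (fun_R k) s t + k 3 s t * D_t (fun_S k) s t =
      - (D_t (k 1) s t * fun_P k s t + D_t (k 2) s t * fun_R k s t + D_t (k 3) s t * fun_S k s t)"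
    by (simp add: D_t_def)
qed

end

subsection \<open>The second fundamental forms\<close>

text \<open>Up to one exchange of rows this is the Sylvester matrix of \<open>a x^2 + c y^2\<close>
  and \<open>2 b x y + d y^2\<close>. The second form has the zeros (1, 0) and (-d, 2 b), and the
  resultant is the product of the values \<open>a\<close> and \<open>a d^2 + 4 b^2 c\<close> of the
  first form there.\<close>

lemma det_sylvester:
  fixes a b c d :: real
  shows "det (vector [vector [a, 0, c, 0], vector [0, 2 * b, d, 0],
      vector [0, a, 0, c], vector [0, 0, 2 * b, d]] :: real^4^4) = - ((a * d)\<^sup>2 + 4 * b\<^sup>2 * (a * c))"
  by (simp add: det_4 vector_4 power2_eq_square algebra_simps)

context bdr_surface
begin

context
  fixes s t
  assumes st: "s \<in> I" "t \<in> J" and W_pos: "fun_W k s t > 0" and Q_pos: "fun_Q k s t > 0"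
begin

abbreviation (input) "Q \<equiv> fun_Q k s t"
abbreviation (input) "W \<equiv> fun_W k s t"

lemma Q_sq: "Q\<^sup>2 = (k 1 s t)\<^sup>2 + (k 2 s t)\<^sup>2 + (k 3 s t)\<^sup>2"
  by (simp add: fun_Q_def)

lemma W_sq: "W\<^sup>2 = (fun_P k s t)\<^sup>2 + (fun_R k s t)\<^sup>2 + (fun_S k s t)\<^sup>2"
  by (simp add: fun_W_def)

lemma inner_normal_N:
  "v \<bullet> normal_N p k 1 s t =
    (k 1 s t * (v \<bullet> p 1 s t) + k 2 s t * (v \<bullet> p 2 s t) + k 3 s t * (v \<bullet> p 3 s t)) / Q"
  "v \<bullet> normal_N p k 2 s t =
    ((k 2 s t * fun_S k s t - k 3 s t * fun_R k s t) * (v \<bullet> p 1 s t)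
     + (k 3 s t * fun_P k s t - k 1 s t * fun_S k s t) * (v \<bullet> p 2 s t)
     + (k 1 s t * fun_R k s t - k 2 s t * fun_P k s t) * (v \<bullet> p 3 s t)) / (Q * W)"
  by (simp_all add: normal_N_def inner_add_right)

text \<open>The second \<open>s\<close>-derivative of \<open>\<Psi>\<close> has normal components
  \<open>k i\<close>, so it is Q times the first normal. The second normal points along the cross
  product of \<open>k\<close> with (P, R, S), which is orthogonal to \<open>k\<close>.\<close>

lemma h11_eq: "h11 \<Psi> p k 1 s t = Q" "h11 \<Psi> p k 2 s t = 0"
proof -
  have "k 1 s t * k 1 s t + k 2 s t * k 2 s t + k 3 s t * k 3 s t = Q * Q"
    using Q_sq by (simp add: power2_eq_square)
  then show "h11 \<Psi> p k 1 s t = Q"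
    using Q_pos by (simp add: h11_def inner_normal_N D_ss_p[OF st])
  have "(k 2 s t * fun_S k s t - k 3 s t * fun_R k s t) * k 1 s t
     + (k 3 s t * fun_P k s t - k 1 s t * fun_S k s t) * k 2 s t
     + (k 1 s t * fun_R k s t - k 2 s t * fun_P k s t) * k 3 s t = 0"
    by algebra
  then show "h11 \<Psi> p k 2 s t = 0"
    by (simp add: h11_def inner_normal_N D_ss_p[OF st])
qed

text \<open>The vector \<open>(P, R, S)\<close> is \<open>k' \<times> k\<close>, so \<open>k \<times> (P, R, S) = Q\<^sup>2 k' - (k \<bullet> k') k\<close>; the second
  term is orthogonal to the derivative of \<open>(P, R, S)\<close>.\<close>

lemma h12_eq: "h12 \<Psi> p k 1 s t = 0" "h12 \<Psi> p k 2 s t = Q * fun_C k s t / W\<^sup>2"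
proof -
  note orth = k_PRS_derivatives(1)[OF st]
  show "h12 \<Psi> p k 1 s t = 0"
    by (simp add: h12_def inner_normal_N D_t_D_s_Psi[OF st] orth)
  have "(k 2 s t * fun_S k s t - k 3 s t * fun_R k s t) * D_s (fun_P k) s t
     + (k 3 s t * fun_P k s t - k 1 s t * fun_S k s t) * D_s (fun_R k) s t
     + (k 1 s t * fun_R k s t - k 2 s t * fun_P k s t) * D_s (fun_S k) s t =
     ((k 1 s t)\<^sup>2 + (k 2 s t)\<^sup>2 + (k 3 s t)\<^sup>2) * fun_C k s t
     - (k 1 s t * D_s (k 1) s t + k 2 s t * D_s (k 2) s t + k 3 s t * D_s (k 3) s t)
     * (k 1 s t * D_s (fun_P k) s t + k 2 s t * D_s (fun_R k) s t + k 3 s t * D_s (fun_S k) s t)"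
    \<comment> \<open>Only the values of P, R, S are expanded; their \<open>s\<close>-derivatives
      stay as independent quantities in a polynomial identity.\<close>
    unfolding fun_C_def fun_P_def[of k s t] fun_R_def[of k s t] fun_S_def[of k s t] by algebra
  also have "\<dots> = Q * Q * fun_C k s t"
    unfolding orth using Q_sq by (simp add: power2_eq_square)
  finally show "h12 \<Psi> p k 2 s t = Q * fun_C k s t / W\<^sup>2"
    using Q_pos W_pos
    by (simp add: h12_def inner_normal_N D_t_D_s_Psi[OF st] power2_eq_square)
qed

lemma h22_eq:
  "h22 \<Psi> p k 1 s t = fun_A p k s t / (Q * W\<^sup>2)" "h22 \<Psi> p k 2 s t = fun_B p k s t / (Q * W ^ 3)"
proof -
  have "k 1 s t * (D_t (D_t \<Psi>) s t \<bullet> p 1 s t) + k 2 s t * (D_t (D_t \<Psi>) s t \<bullet> p 2 s t)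
      + k 3 s t * (D_t (D_t \<Psi>) s t \<bullet> p 3 s t) = fun_A p k s t"
    unfolding D_t_D_t_Psi[OF st] fun_A_def using k_PRS_derivatives(2)[OF st] by algebra
  then show "h22 \<Psi> p k 1 s t = fun_A p k s t / (Q * W\<^sup>2)"
    by (simp add: h22_def inner_normal_N)
  \<comment> \<open>Write V = (P, R, S) and w = (\<open>fr_a34\<close>, \<open>- fr_a24\<close>,
    \<open>fr_a23\<close>). The rotation of the frame adds w x V to the components of
    \<open>D_t (D_t \<Psi>)\<close>, and (k x V) . (w x V) = (k . w) W^2 because k . V = 0; this is
    the first term of \<open>fun_B\<close>.\<close>
  have "(k 2 s t * fun_S k s t - k 3 s t * fun_R k s t) * (D_t (D_t \<Psi>) s t \<bullet> p 1 s t)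
     + (k 3 s t * fun_P k s t - k 1 s t * fun_S k s t) * (D_t (D_t \<Psi>) s t \<bullet> p 2 s t)
     + (k 1 s t * fun_R k s t - k 2 s t * fun_P k s t) * (D_t (D_t \<Psi>) s t \<bullet> p 3 s t) = fun_B p k s t"
    unfolding D_t_D_t_Psi[OF st] fun_B_def W_sq using k_orthogonal_PRS[of s t] by algebra
  then show "h22 \<Psi> p k 2 s t = fun_B p k s t / (Q * W ^ 3)"
    by (simp add: h22_def inner_normal_N power2_eq_square power3_eq_cube)
qed

lemma ellipse_Delta_eq:
  "ellipse_Delta \<Psi> p k s t =
    - ((fun_B p k s t)\<^sup>2 + 4 * Q\<^sup>2 * fun_A p k s t * (fun_C k s t)\<^sup>2) / (4 * W ^ 6)"
proof -
  have powers: "(W ^ 3)\<^sup>2 = W ^ 6" "(W\<^sup>2)\<^sup>2 * W\<^sup>2 = W ^ 6"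
    by (simp_all flip: power_mult power_add)
  have Q0: "Q \<noteq> 0" using Q_pos by simp
  have "ellipse_Delta \<Psi> p k s t =
    - ((Q * (fun_B p k s t / (Q * W ^ 3)))\<^sup>2
      + 4 * (Q * fun_C k s t / W\<^sup>2)\<^sup>2 * (Q * (fun_A p k s t / (Q * W\<^sup>2)))) / 4"
    \<comment> \<open>The vanishing of \<open>h11\<close> for the second normal and of
      \<open>h12\<close> for the first brings the matrix into the shape of
      \<open>det_sylvester\<close>.\<close>
    unfolding ellipse_Delta_def h11_eq h12_eq h22_eq mult_zero_right det_sylvester by simp
  also have "\<dots> = - ((fun_B p k s t / W ^ 3)\<^sup>2
      + 4 * (Q * fun_C k s t / W\<^sup>2)\<^sup>2 * (fun_A p k s t / W\<^sup>2)) / 4"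
    using Q0 by simp
  also have "\<dots> = - ((fun_B p k s t)\<^sup>2 / W ^ 6
      + 4 * (Q\<^sup>2 * (fun_C k s t)\<^sup>2 * fun_A p k s t) / W ^ 6) / 4"
    by (simp add: power_divide power_mult_distrib powers)
  also have "\<dots> = - ((fun_B p k s t)\<^sup>2 + 4 * Q\<^sup>2 * fun_A p k s t * (fun_C k s t)\<^sup>2) / (4 * W ^ 6)"
    by (simp add: add_divide_distrib diff_divide_distrib mult_ac)
  finally show ?thesis .
qed

lemma Gaussian_K_eq:
  "Gaussian_K \<Psi> p k s t = fun_A p k s t / W\<^sup>2 - (Q * fun_C k s t / W\<^sup>2)\<^sup>2"
proof -
  have "{1..2::nat} = {1, 2}" by auto
  then show ?thesis
    using Q_pos by (simp add: Gaussian_K_def h11_eq h12_eq h22_eq)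
qed

lemma rank_matrix_A:
  assumes "fun_B p k s t \<noteq> 0 \<or> fun_C k s t \<noteq> 0"
  shows "rank (matrix_A \<Psi> p k s t) = 2"
  unfolding matrix_A_def h11_eq h12_eq h22_eq
  by (rule rank_2_matrix) (use assms Q_pos W_pos in auto)

end

lemma Q_W_pos:
  assumes "standing_assumptions I J k" "s \<in> I" "t \<in> J"
  shows "fun_W k s t > 0" and "fun_Q k s t > 0"
proof -
  have V: "\<not> (fun_P k s t = 0 \<and> fun_R k s t = 0 \<and> fun_S k s t = 0)"
    using assms by (auto simp: standing_assumptions_def)
  then show "fun_W k s t > 0"
    by (auto simp: fun_W_def add_nonneg_eq_0_iff less_le)
  \<comment> \<open>P, R and S are linear in the values of \<open>k\<close>, so they would all
    vanish at a zero of \<open>k\<close>.\<close>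
  from V have "\<not> (k 1 s t = 0 \<and> k 2 s t = 0 \<and> k 3 s t = 0)"
    by (auto simp: fun_P_def fun_R_def fun_S_def)
  then show "fun_Q k s t > 0"
    by (auto simp: fun_Q_def add_nonneg_eq_0_iff less_le)
qed

end

text \<open>In the alternative A < 0 the case B = C = 0 is excluded: there the second row of
  \<open>matrix_A\<close> vanishes and the first does not, so the rank is 1. As K < 0, such a point
  is an inflection point of real type and the ellipse is degenerate.\<close>

theorem theorem10:
  fixes I J :: "real set"
    and \<Psi> T :: "real \<Rightarrow> real \<Rightarrow> real^4"
    and p :: "nat \<Rightarrow> real \<Rightarrow> real \<Rightarrow> real^4"
    and k :: "nat \<Rightarrow> real \<Rightarrow> real \<Rightarrow> real"
    and s t :: real
  assumes "unit_speed_map I J \<Psi>"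
    and "Betchov_Da_Rios I J \<Psi>"
    and "parallel_transport_frame I J \<Psi> T p k"
    and "standing_assumptions I J k"
    and "s \<in> I" and "t \<in> J"
  shows "let A = fun_A p k s t; B = fun_B p k s t; C = fun_C k s t; Q = fun_Q k s t in
    (B\<^sup>2 + 4 * Q\<^sup>2 * A * C\<^sup>2 > 0 \<longrightarrow>
       origin_outside_ellipse \<Psi> p k s t \<and> hyperbolic_point \<Psi> p k s t) \<and>
    (B\<^sup>2 + 4 * Q\<^sup>2 * A * C\<^sup>2 < 0 \<longrightarrow>
       origin_inside_ellipse \<Psi> p k s t \<and> elliptic_point \<Psi> p k s t) \<and>
    (B\<^sup>2 + 4 * Q\<^sup>2 * A * C\<^sup>2 = 0 \<longrightarrow>
       origin_on_ellipse \<Psi> p k s t \<and> parabolic_point \<Psi> p k s t \<and>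
       (A > 0 \<and> B = 0 \<and> C = 0 \<longrightarrow> inflection_imaginary_type \<Psi> p k s t) \<and>
       ((A < 0 \<and> B\<^sup>2 + 4 * Q\<^sup>2 * A * C\<^sup>2 = 0 \<and> \<not> (B = 0 \<and> C = 0)) \<or>
        (A = 0 \<and> B = 0 \<and> C \<noteq> 0) \<longrightarrow> ellipse_nondegenerate \<Psi> p k s t) \<and>
       (A = 0 \<and> B = 0 \<and> C = 0 \<longrightarrow> inflection_flat_type \<Psi> p k s t))"
proof -
  interpret bdr_surface I J \<Psi> T p k
    by standard (rule assms)+
  note pos = Q_W_pos[OF assms(4-6)]
  define A B C Q W where "A = fun_A p k s t" and "B = fun_B p k s t" and "C = fun_C k s t"
    and "Q = fun_Q k s t" and "W = fun_W k s t"
  note defs = A_def[symmetric] B_def[symmetric] C_def[symmetric] Q_def[symmetric] W_def[symmetric]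
  have Q: "Q > 0" and W: "W > 0"
    using pos by (simp_all add: Q_def W_def)
  have \<Delta>: "ellipse_Delta \<Psi> p k s t = - (B\<^sup>2 + 4 * Q\<^sup>2 * A * C\<^sup>2) / (4 * W ^ 6)"
    using ellipse_Delta_eq[OF assms(5,6) pos] unfolding defs .
  have K: "Gaussian_K \<Psi> p k s t = A / W\<^sup>2 - (Q * C / W\<^sup>2)\<^sup>2"
    using Gaussian_K_eq[OF assms(5,6) pos] unfolding defs .
  have rank: "rank (matrix_A \<Psi> p k s t) = 2" if "B \<noteq> 0 \<or> C \<noteq> 0"
    using rank_matrix_A[OF assms(5,6) pos] that unfolding defs .
  have W6: "4 * W ^ 6 > 0"
    using W by simp
  have neg: "ellipse_Delta \<Psi> p k s t < 0" if "B\<^sup>2 + 4 * Q\<^sup>2 * A * C\<^sup>2 > 0"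
    unfolding \<Delta> using that W6 by (intro divide_neg_pos) simp_all
  have "ellipse_Delta \<Psi> p k s t > 0" if "B\<^sup>2 + 4 * Q\<^sup>2 * A * C\<^sup>2 < 0"
    unfolding \<Delta> using that W6 by (intro divide_pos_pos) simp_all
  moreover have "ellipse_Delta \<Psi> p k s t = 0" if "B\<^sup>2 + 4 * Q\<^sup>2 * A * C\<^sup>2 = 0"
    unfolding \<Delta> that by simp
  moreover have "Gaussian_K \<Psi> p k s t > 0" if "A > 0" "C = 0"
    unfolding K using that W by simp
  moreover have "Gaussian_K \<Psi> p k s t < 0" if "A < 0"
  proof -
    have "A / W\<^sup>2 < 0" using that W by (intro divide_neg_pos) simp_all
    then show ?thesis unfolding K using zero_le_power2[of "Q * C / W\<^sup>2"] by linarith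
  qed
  moreover have "Gaussian_K \<Psi> p k s t < 0" if "A = 0" "C \<noteq> 0"
    unfolding K using that Q W by simp
  moreover have "Gaussian_K \<Psi> p k s t = 0" if "A = 0" "C = 0"
    unfolding K using that by simp
  ultimately show ?thesis
    unfolding Let_def defs origin_outside_ellipse_def origin_inside_ellipse_def origin_on_ellipse_def
      hyperbolic_point_def elliptic_point_def parabolic_point_def inflection_imaginary_type_def
      inflection_flat_type_def ellipse_nondegenerate_def
    using neg rank by blast
qed

end
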